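(* Let $\mathbb{E}_1,\mathbb{E}_2$ be Euclidean spaces, let $K\subset\mathbb{E}_2$ be a proper, closed, convex cone such that $K\subset-K^\circ$ and let $F:\mathbb{E}_1\to\mathbb{E}_2^\bullet$ be proper, $K$-convex and $K$-closed with $\mathrm{ri}\,K\subset\mathrm{rge}\,F$. Moreover, assume that, for any $u\in\mathrm{ri}\,K$, there exists a nonempty convex set $C^u\subset F^{-1}(\mathbb{R}_+u)$ such that $f_u:=\langle u,F\rangle+\delta_{C^u}$ does not have any affine majorant on its domain. Then $K\text{-}\mathrm{epi}\,F=\overline{\mathrm{conv}}(\mathrm{gph}\,F)$.
   Context: A Euclidean space is a finite-dimensional real inner product space. A cone is a nonempty set $K$ with $\lambda x\in K$ for all $\lambda\ge0$, $x\in K$; a cone $K\subset\mathbb{E}_2$ is proper if $\{0\}\neq K\ne\mathbb{E}_2$. $K^\circ:=\{v : \langle u,v\rangle\le0\ \forall u\in K\}$; $\mathrm{ri}$ denotes relative interior; $\mathbb{R}_+u=\{\lambda u : \lambda\ge0\}$. $\mathbb{E}_2^\bullet:=\mathbb{E}_2\cup\{+\infty_\bullet\}$ with a formal largest element; $\mathrm{dom}\,F:=\{x : F(x)\in\mathbb{E}_2\}$, $\mathrm{rge}\,F:=F(\mathrm{dom}\,F)$, $\mathrm{gph}\,F:=\{(x,F(x)) : x\in\mathrm{dom}\,F\}$, $K\text{-}\mathrm{epi}\,F:=\{(x,y)\in\mathrm{dom}\,F\times\mathbb{E}_2 : y-F(x)\in K\}$. $F$ is proper if $\mathrm{dom}\,F\neq\emptyset$,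 $K$-convex (resp. $K$-closed) if $K\text{-}\mathrm{epi}\,F$ is convex (resp. closed in $\mathbb{E}_1\times\mathbb{E}_2$). $\overline{\mathrm{conv}}$ is the closed convex hull. $\langle u,F\rangle(x)=\langle u,F(x)\rangle$ for $x\in\mathrm{dom}\,F$ and $+\infty$ otherwise; $\delta_C$ is $0$ on $C$ and $+\infty$ elsewhere. An affine majorant of $f$ on its domain is an affine function $\phi:\mathbb{E}_1\to\mathbb{R}$ with $f(x)\le\phi(x)$ for all $x\in\mathrm{dom}\,f:=\{x : f(x)<+\infty\}$. *)

theory Defs
  imports "HOL-Analysis.Analysis"
begin

text \<open>
  A map into a Euclidean space extended by a formal largest element is modelled as a partial
  function \<open>F :: 'a \<rightharpoonup> 'b\<close>, where \<open>None\<close> plays the role of the formal largest element.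
  Domain, range and graph of \<open>F\<close> are then the library's \<^const>\<open>dom\<close>, \<^const>\<open>ran\<close>
  and \<^const>\<open>Map.graph\<close>.
\<close>

text \<open>The library's \<^const>\<open>cone\<close> admits the empty set, so nonemptiness is required separately.\<close>

definition proper_cone :: "'b::real_vector set \<Rightarrow> bool" where
  "proper_cone K \<longleftrightarrow> K \<noteq> {} \<and> cone K \<and> K \<noteq> {0} \<and> K \<noteq> UNIV"

definition polar_cone :: "'b::real_inner set \<Rightarrow> 'b set" where
  "polar_cone K = {v. \<forall>u\<in>K. inner u v \<le> 0}"

definition ray :: "'b::real_vector \<Rightarrow> 'b set" where
  "ray u = {c *\<^sub>R u | c. 0 \<le> c}"

definition K_epi :: "'b set \<Rightarrow> ('a \<rightharpoonup> 'b) \<Rightarrow> ('a \<times> 'b::ab_group_add) set" where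
  "K_epi K F = {(x, y). x \<in> dom F \<and> y - the (F x) \<in> K}"

definition proper_pfun :: "('a \<rightharpoonup> 'b) \<Rightarrow> bool" where
  "proper_pfun F \<longleftrightarrow> dom F \<noteq> {}"

definition K_convex :: "'b::real_vector set \<Rightarrow> ('a::real_vector \<rightharpoonup> 'b) \<Rightarrow> bool" where
  "K_convex K F \<longleftrightarrow> convex (K_epi K F)"

definition K_closed :: "'b::real_normed_vector set \<Rightarrow> ('a::topological_space \<rightharpoonup> 'b) \<Rightarrow> bool" where
  "K_closed K F \<longleftrightarrow> closed (K_epi K F)"

definition scalarization :: "'b::real_inner \<Rightarrow> ('a \<rightharpoonup> 'b) \<Rightarrow> 'a \<Rightarrow> ereal" where
  "scalarization u F x = (case F x of Some y \<Rightarrow> ereal (inner u y) | None \<Rightarrow> \<infinity>)"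

definition indicator_inf :: "'a set \<Rightarrow> 'a \<Rightarrow> ereal" where
  "indicator_inf C x = (if x \<in> C then 0 else \<infinity>)"

definition affine_function :: "('a::real_vector \<Rightarrow> real) \<Rightarrow> bool" where
  "affine_function \<phi> \<longleftrightarrow> (\<exists>g b. linear g \<and> (\<forall>x. \<phi> x = g x + b))"

definition has_affine_majorant :: "('a::real_vector \<Rightarrow> ereal) \<Rightarrow> bool" where
  "has_affine_majorant f \<longleftrightarrow>
     (\<exists>\<phi>. affine_function \<phi> \<and> (\<forall>x \<in> {x. f x < \<infinity>}. f x \<le> ereal (\<phi> x)))"

end

theory Submission
  imports Defs
begin

text \<open>
  The epigraph is a closed convex set containing the graph, so it contains the closed convex hull
  of the graph. For the other inclusion, suppose that a point
  \<open>(x, y)\<close> of the epigraph is strictly separated from the closed convex hull of the graph by a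
  functional \<open>(p, q) \<mapsto> \<langle>a, p\<rangle> + \<langle>b, q\<rangle>\<close>, which is bounded above by
  \<open>\<beta>\<close> on the graph. Comparing \<open>(x, y)\<close> with the graph point over \<open>x\<close> shows that
  \<open>b\<close> is positive at \<open>y - F x \<in> K\<close>, hence, by density of the relative interior,
  positive at some \<open>u\<close> in the relative interior of \<open>K\<close>. Where \<open>F\<close> takes a value
  \<open>c u\<close>, the bound on the graph reads \<open>\<langle>a, p\<rangle> + c \<langle>b, u\<rangle> \<le> \<beta>\<close>.
  Since \<open>\<langle>b, u\<rangle> > 0\<close>, it can be solved for \<open>c\<close>: it bounds \<open>c\<close>, and with it
  \<open>\<langle>u, F p\<rangle> = c \<langle>u, u\<rangle>\<close>, by an affine function of \<open>p\<close>. This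
  contradicts the assumption on \<open>C\<^sup>u\<close>. In other words, the absence of an affine majorant
  makes \<open>(0, u)\<close> a recession direction of the closed convex hull for every \<open>u\<close> in the
  relative interior of \<open>K\<close>.
\<close>

lemma graph_subset_K_epi:
  assumes "0 \<in> K"
  shows "Map.graph F \<subseteq> K_epi K F"
  using assms by (auto simp: Map.graph_def K_epi_def)

text \<open>A non-vertical upper half-space containing the graph is an affine majorant along the ray.\<close>

lemma has_affine_majorant_if_graph_bounded:
  fixes F :: "'a::real_inner \<rightharpoonup> 'b::real_inner"
  assumes bound: "\<And>p q. F p = Some q \<Longrightarrow> inner a p + inner b q \<le> \<beta>"
    and pos: "0 < inner b u"
    and C: "C \<subseteq> F -` (Some ` ray u)"
  shows "has_affine_majorant (\<lambda>x. scalarization u F x + indicator_inf C x)"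
proof -
  define \<phi> where "\<phi> = (\<lambda>p. (\<beta> - inner a p) / inner b u * inner u u)"
  have "linear (\<lambda>p. - (inner u u / inner b u) * inner a p)"
    by (intro linearI) (auto simp: inner_right_distrib algebra_simps add_divide_distrib)
  moreover have "\<phi> p = - (inner u u / inner b u) * inner a p + \<beta> / inner b u * inner u u" for p
    unfolding \<phi>_def by (simp add: diff_divide_distrib algebra_simps)
  ultimately have affine: "affine_function \<phi>"
    unfolding affine_function_def by blast
  have "scalarization u F p + indicator_inf C p \<le> ereal (\<phi> p)"
    if fin: "scalarization u F p + indicator_inf C p < \<infinity>" for p
  proof -
    have "p \<in> C"
      using fin by (auto simp: indicator_inf_def split: if_splits)
    then obtain c where Fp: "F p = Some (c *\<^sub>R u)"
      using C by (auto simp: ray_def)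
    have "c \<le> (\<beta> - inner a p) / inner b u"
      using bound[OF Fp] pos by (simp add: pos_le_divide_eq)
    then have "c * inner u u \<le> \<phi> p"
      unfolding \<phi>_def by (intro mult_right_mono) auto
    then show ?thesis
      using Fp \<open>p \<in> C\<close> by (simp add: scalarization_def indicator_inf_def)
  qed
  with affine show ?thesis
    unfolding has_affine_majorant_def by blast
qed

lemma rel_interior_inner_pos:
  fixes K :: "'b::euclidean_space set"
  assumes "convex K" "k \<in> K" "0 < inner b k"
  obtains u where "u \<in> rel_interior K" "0 < inner b u"
proof -
  have "k \<in> closure (rel_interior K)"
    using assms convex_closure_rel_interior closure_subset by blast
  then have "{v. 0 < inner b v} \<inter> closure (rel_interior K) \<noteq> {}"
    using assms by blast
  then have "{v. 0 < inner b v} \<inter> rel_interior K \<noteq> {}"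
    using open_Int_closure_eq_empty[OF open_halfspace_gt[of 0 b]] by (simp add: inner_commute)
  then show thesis
    using that by blast
qed

theorem proposition48:
  fixes K :: "'b::euclidean_space set"
    and F :: "'a::euclidean_space \<rightharpoonup> 'b"
  assumes "proper_cone K" and "closed K" and "convex K"
    and "K \<subseteq> uminus ` polar_cone K"
    and "proper_pfun F" and "K_convex K F" and "K_closed K F"
    and "rel_interior K \<subseteq> ran F"
    and "\<forall>u \<in> rel_interior K. \<exists>C. C \<noteq> {} \<and> convex C \<and> C \<subseteq> F -` (Some ` ray u) \<and>
           \<not> has_affine_majorant (\<lambda>x. scalarization u F x + indicator_inf C x)"
  shows "K_epi K F = closure (convex hull (Map.graph F))"
proof
  have "0 \<in> K"
    using assms(1) cone_contains_0[of K] by (auto simp: proper_cone_def)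
  then show "closure (convex hull (Map.graph F)) \<subseteq> K_epi K F"
    using assms(6,7) graph_subset_K_epi[of K F]
    by (intro closure_minimal hull_minimal) (auto simp: K_convex_def K_closed_def)
next
  let ?G = "closure (convex hull (Map.graph F))"
  show "K_epi K F \<subseteq> ?G"
  proof (rule subsetI, rule ccontr)
    fix z assume z: "z \<in> K_epi K F" and "z \<notin> ?G"
    obtain x y Fx where xy: "z = (x, y)" "F x = Some Fx" "y - Fx \<in> K"
      using z by (auto simp: K_epi_def)
    obtain w \<gamma> where w: "inner w z < \<gamma>" "\<forall>g\<in>?G. \<gamma> < inner w g"
      using separating_hyperplane_closed_point[of ?G z] \<open>z \<notin> ?G\<close>
      by (auto simp: convex_closure)
    \<comment> \<open>Negating the separating functional makes it bounded above on the graph.\<close>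
    define a b \<beta> where "a = - fst w" and "b = - snd w" and "\<beta> = - \<gamma>"
    have bound: "inner a p + inner b q < \<beta>" if "F p = Some q" for p q
    proof -
      have "(p, q) \<in> Map.graph F"
        using that by (simp add: Map.graph_def)
      then have "(p, q) \<in> ?G"
        using hull_subset closure_subset by (metis subsetD)
      then show ?thesis
        using w(2) by (auto simp: a_def b_def \<beta>_def inner_prod_def)
    qed
    have "\<beta> < inner a x + inner b y"
      using w(1) xy(1) by (auto simp: a_def b_def \<beta>_def inner_prod_def)
    then have "0 < inner b (y - Fx)"
      using bound[OF xy(2)] by (simp add: inner_diff_right)
    then obtain u where u: "u \<in> rel_interior K" "0 < inner b u"
      using rel_interior_inner_pos \<open>convex K\<close> xy(3) by blast
    then obtain C where C: "C \<subseteq> F -` (Some ` ray u)"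
      "\<not> has_affine_majorant (\<lambda>x. scalarization u F x + indicator_inf C x)"
      using assms(9) by blast
    show False
      using C has_affine_majorant_if_graph_bounded[OF less_imp_le[OF bound] u(2) C(1)] by blast
  qed
qed

end
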